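(* Let $q$ be a power of $2$ with $q\ge 4$, and let $\mathcal{D}(q)$ be a quasi-symmetric design of Blokhuis-Haemers type. Then the binary linear code spanned by the rows of a block-by-point incidence matrix of $\mathcal{D}(q)$ is doubly even and self-orthogonal.
   Context: A $2$-$(v,k,\lambda)$ design is a finite incidence structure $(\mathcal{P},\mathcal{B},\mathcal{I})$ with $v$ points, each block incident with exactly $k$ points, and any two distinct points incident with exactly $\lambda$ common blocks; it is symmetric if the number of blocks equals $v$. For $0\le s<k$, $s$ is a block intersection number if there are two blocks with exactly $s$ common points; the design is quasi-symmetric if it has exactly two block intersection numbers $x<y$. Designs of Blokhuis-Haemers type: let $q$ be a power of $2$. Let $\mathcal{D}_1$ be a symmetric $2$-$(q^2,q(q-1)/2,q(q-2)/4)$ design whose blocks are maximal arcs in the affine plane $AG(2,q)$ (sets of $q(q-1)/2$ points meeting every line in $0$ or $q/2$ points), and let $\mathcal{D}_2$ be the resolvable $2$-$(q^3,q,1)$ design of points and lines of $AG(3,q)$. For every parallel class $P$ of $q^2$ lines of $AG(3,q)$, label the lines in $P$ by the points of $\mathcal{D}_1$, and for each block $B$ of $\mathcal{D}_1$ define a block of the new design as the union of the $q(q-1)/2$ lines of $P$ labelled by the points of $B$; here the labelling is such that the sets of lines labelled by blocks of $\mathcal{D}_1$ are maximal arcs in the quotient affine plane $AG(2,q)$ whose points are the lines of $P$ (and whose lines are given by the planes of $AG(3,q)$ that are unions of lines of $P$). The points of the new design are the points of $AG(3,q)$, and its blocks are all the blocks obtained in this way from all parallel classes. The resulting design $\mathcal{D}(q)$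 is called a design of Blokhuis-Haemers type. It is known (Blokhuis and Haemers) that $\mathcal{D}(q)$ is a quasi-symmetric $2$-$(q^3,\,q^2(q-1)/2,\,q(q^3-q^2-2)/4)$ design with block intersection numbers $x=q^2(q-2)/4$ and $y=q^2(q-1)/4$. The block-by-point incidence matrix is the $0/1$ matrix with rows indexed by blocks and columns by points, with entry $1$ exactly when the point is incident with the block; entries are read in $\mathbb{F}_2$. A binary code is doubly even if all codewords have weight divisible by $4$, and self-orthogonal if $C\subseteq C^\perp$ for the standard inner product. *)

theory Defs
  imports "HOL-Analysis.Analysis" "HOL-Library.Z2"
begin

section \<open>Incidence structures and designs\<close>

record ('p, 'b) incidence_structure =
  points :: "'p set"
  blocks :: "'b set"
  incident :: "'p \<Rightarrow> 'b \<Rightarrow> bool"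

definition set_structure :: "'p set \<Rightarrow> 'p set set \<Rightarrow> ('p, 'p set) incidence_structure" where
  "set_structure X \<B> = \<lparr>points = X, blocks = \<B>, incident = (\<in>)\<rparr>"

definition two_design :: "('p, 'b) incidence_structure \<Rightarrow> nat \<Rightarrow> nat \<Rightarrow> nat \<Rightarrow> bool" where
  "two_design D v k lam \<longleftrightarrow>
     finite (points D) \<and> finite (blocks D) \<and>
     card (points D) = v \<and>
     (\<forall>B \<in> blocks D. card {p \<in> points D. incident D p B} = k) \<and>
     (\<forall>p \<in> points D. \<forall>r \<in> points D. p \<noteq> r \<longrightarrow>
        card {B \<in> blocks D. incident D p B \<and> incident D r B} = lam)"

definition symmetric_two_design :: "('p, 'b) incidence_structure \<Rightarrow> nat \<Rightarrow> nat \<Rightarrow> nat \<Rightarrow> bool" where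
  "symmetric_two_design D v k lam \<longleftrightarrow> two_design D v k lam \<and> card (blocks D) = v"

definition block_intersection_numbers :: "('p, 'b) incidence_structure \<Rightarrow> nat \<Rightarrow> nat set" where
  "block_intersection_numbers D k =
     {s. s < k \<and> (\<exists>B \<in> blocks D. \<exists>C \<in> blocks D.
            card {p \<in> points D. incident D p B \<and> incident D p C} = s)}"

definition quasi_symmetric :: "('p, 'b) incidence_structure \<Rightarrow> bool" where
  "quasi_symmetric D \<longleftrightarrow>
     (\<exists>v k lam x y. two_design D v k lam \<and> x < y \<and> block_intersection_numbers D k = {x, y})"


section \<open>Affine geometry over a finite field\<close>

text \<open>The points of $AG(n,q)$ are the vectors of \<open>'a ^ 'n\<close>, where \<open>'a\<close> is a field with \<open>q\<close>
  elements; its \<open>d\<close>-flats are the cosets of the \<open>d\<close>-dimensional linear subspaces.\<close>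

definition affine_flat :: "nat \<Rightarrow> (('a::field) ^ 'n) set \<Rightarrow> bool" where
  "affine_flat d S \<longleftrightarrow> (\<exists>a V. vec.subspace V \<and> vec.dim V = d \<and> S = (\<lambda>x. a + x) ` V)"

abbreviation "affine_line \<equiv> affine_flat 1"
abbreviation "affine_plane \<equiv> affine_flat 2"

definition parallel_class :: "(('a::field) ^ 'n) set \<Rightarrow> ('a ^ 'n) set set" where
  "parallel_class L = {M. affine_line M \<and> (\<exists>c. M = (\<lambda>x. c + x) ` L)}"

definition parallel_classes :: "(('a::field) ^ 'n) set set set" where
  "parallel_classes = {parallel_class L |L. affine_line L}"

text \<open>The lines of the quotient plane $AG(2,q)$ whose points are the lines in the parallel
  class \<open>P\<close> of $AG(3,q)$.\<close>

definition quotient_lines :: "(('a::field) ^ 3) set set \<Rightarrow> ('a ^ 3) set set set" where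
  "quotient_lines P = {{L \<in> P. L \<subseteq> E} |E. affine_plane E \<and> (\<exists>Q \<subseteq> P. E = \<Union>Q)}"

text \<open>Maximal arcs in an affine plane of order \<open>q\<close> (\<open>q\<close> even) with point set \<open>X\<close> and line set
  \<open>\<L>\<close>.\<close>

definition maximal_arc :: "nat \<Rightarrow> 'p set \<Rightarrow> 'p set set \<Rightarrow> 'p set \<Rightarrow> bool" where
  "maximal_arc q X \<L> A \<longleftrightarrow>
     A \<subseteq> X \<and> card A = q * (q - 1) div 2 \<and>
     (\<forall>l \<in> \<L>. card (A \<inter> l) = 0 \<or> card (A \<inter> l) = q div 2)"


section \<open>Designs of Blokhuis-Haemers type\<close>

text \<open>\<open>\<A>\<close> is the block set of the symmetric design $\mathcal{D}_1$ on the points of $AG(2,q)$,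
  and \<open>label P\<close> is the labelling of the lines in the parallel class \<open>P\<close> by the points of
  $\mathcal{D}_1$.  For even \<open>q\<close> all divisions below are exact.\<close>

definition blokhuis_haemers_type ::
    "nat \<Rightarrow> (('a::{field,finite}) ^ 3, ('a ^ 3) set) incidence_structure \<Rightarrow> bool" where
  "blokhuis_haemers_type q D \<longleftrightarrow>
     CARD('a) = q \<and>
     (\<exists>(\<A> :: ('a ^ 2) set set) (label :: ('a ^ 3) set set \<Rightarrow> ('a ^ 3) set \<Rightarrow> 'a ^ 2).
        symmetric_two_design (set_structure UNIV \<A>)
          (q ^ 2) (q * (q - 1) div 2) (q * (q - 2) div 4) \<and>
        (\<forall>B \<in> \<A>. maximal_arc q UNIV {l. affine_line l} B) \<and>
        (\<forall>P \<in> parallel_classes.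
           bij_betw (label P) P UNIV \<and>
           (\<forall>B \<in> \<A>. maximal_arc q P (quotient_lines P) {L \<in> P. label P L \<in> B})) \<and>
        D = set_structure UNIV {\<Union>{L \<in> P. label P L \<in> B} |P B. P \<in> parallel_classes \<and> B \<in> \<A>})"


section \<open>Binary codes\<close>

text \<open>Row \<open>B\<close> of the block-by-point incidence matrix over $\mathbb{F}_2$.  The columns are indexed
  by the whole type \<open>'p\<close>, so this is meant for structures with \<open>points D = UNIV\<close>.\<close>

definition incidence_row :: "('p::finite, 'b) incidence_structure \<Rightarrow> 'b \<Rightarrow> bit ^ 'p" where
  "incidence_row D B = (\<chi> p. if incident D p B then 1 else 0)"

definition binary_code :: "('p::finite, 'b) incidence_structure \<Rightarrow> (bit ^ 'p) set" where
  "binary_code D = vec.span (incidence_row D ` blocks D)"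

definition weight :: "bit ^ 'p::finite \<Rightarrow> nat" where
  "weight c = card {i. c $ i \<noteq> 0}"

definition doubly_even :: "(bit ^ 'p::finite) set \<Rightarrow> bool" where
  "doubly_even C \<longleftrightarrow> (\<forall>c \<in> C. 4 dvd weight c)"

definition dual_code :: "(bit ^ 'p::finite) set \<Rightarrow> (bit ^ 'p) set" where
  "dual_code C = {x. \<forall>c \<in> C. (\<Sum>i\<in>UNIV. x $ i * c $ i) = 0}"

definition self_orthogonal :: "(bit ^ 'p::finite) set \<Rightarrow> bool" where
  "self_orthogonal C \<longleftrightarrow> C \<subseteq> dual_code C"

end

theory Submission
  imports Defs
begin

text \<open>A binary code is doubly even and self-orthogonal as soon as its generators have weights
  divisible by 4 and pairwise overlaps of even size (\<open>binary_code_of_even_overlaps\<close>). So the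
  claim is about the sizes of the blocks and of their pairwise intersections.

  A block is a union \<open>\<Union>A\<close> of parallel lines, where \<open>A\<close> is a maximal arc in the quotient
  plane of its parallel class. The key fact is that \<open>\<Union>A\<close> is a set of even type: it meets every
  line \<open>M\<close> of $AG(3,q)$ in an even number of points
  (\<open>maximal_arc_union_meets_lines_evenly\<close>). If \<open>M\<close> belongs to the parallel class,
  this number is \<open>0\<close> or \<open>q\<close>. Otherwise \<open>M\<close> projects bijectively onto a line of the quotient
  plane, and the arc property leaves only \<open>0\<close> and \<open>q / 2\<close>; both are even since 4 divides \<open>q\<close>.

  Every block is also a disjoint union of lines, each with \<open>q\<close> points. Hence its size is a
  multiple of \<open>q\<close>, and its intersection with any block is a disjoint union of
  sets of even size.\<close>


section \<open>Binary codes spanned by evenly overlapping rows\<close>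

lemma of_nat_bit_eq_0_iff: "(of_nat n :: bit) = 0 \<longleftrightarrow> even n"
  by (induction n) (auto simp: bit_not_zero_iff)

lemma inner_product_bit_eq_0_iff:
  fixes x c :: "bit ^ 'p::finite"
  shows "(\<Sum>i\<in>UNIV. x $ i * c $ i) = 0 \<longleftrightarrow> even (card {i. x $ i \<noteq> 0 \<and> c $ i \<noteq> 0})"
proof -
  have "(\<Sum>i\<in>UNIV. x $ i * c $ i) = (\<Sum>i\<in>UNIV. if x $ i \<noteq> 0 \<and> c $ i \<noteq> 0 then 1 else 0)"
    by (intro sum.cong) auto
  also have "\<dots> = of_nat (card {i. x $ i \<noteq> 0 \<and> c $ i \<noteq> 0})"
    by (simp add: sum.If_cases)
  finally show ?thesis by (simp only: of_nat_bit_eq_0_iff)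
qed

lemma mem_dual_code_iff:
  "x \<in> dual_code C \<longleftrightarrow> (\<forall>c\<in>C. even (card {i. x $ i \<noteq> 0 \<and> c $ i \<noteq> 0}))"
  by (simp only: dual_code_def inner_product_bit_eq_0_iff mem_Collect_eq)

lemma weight_add:
  fixes x y :: "bit ^ 'p::finite"
  shows "weight (x + y) + 2 * card {i. x $ i \<noteq> 0 \<and> y $ i \<noteq> 0} = weight x + weight y"
proof -
  define S T where "S = {i. x $ i \<noteq> 0}" and "T = {i. y $ i \<noteq> 0}"
  have "a + b \<noteq> 0 \<longleftrightarrow> (a \<noteq> 0) \<noteq> (b \<noteq> 0)" for a b :: bit
    by (cases a; cases b) auto
  hence "{i. (x + y) $ i \<noteq> 0} = (S - T) \<union> (T - S)"
    by (auto simp: S_def T_def)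
  hence "weight (x + y) = card (S - T) + card (T - S)"
    by (simp add: weight_def card_Un_disjoint Diff_Int_distrib2 disjoint_iff)
  moreover have "card (S - T) + card (S \<inter> T) = card S" "card (T - S) + card (S \<inter> T) = card T"
    using card_Int_Diff[of S T] card_Int_Diff[of T S] by (simp_all add: Int_commute)
  moreover have "{i. x $ i \<noteq> 0 \<and> y $ i \<noteq> 0} = S \<inter> T"
    by (auto simp: S_def T_def)
  moreover have "weight x = card S" "weight y = card T"
    by (simp_all only: weight_def S_def T_def)
  ultimately show ?thesis by simp
qed

lemma subspace_dual_code: "vec.subspace (dual_code C)"
  unfolding vec.subspace_def dual_code_def
  by (auto simp: distrib_right sum.distrib mult.assoc simp flip: sum_distrib_left
      simp del: add_bit_eq_xor mult_bit_eq_and)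

text \<open>The dual of any set is a subspace, so the generators may be replaced by their span in one
  argument of the inner product and then, by symmetry, in the other.\<close>

lemma self_orthogonal_span:
  assumes "R \<subseteq> dual_code R"
  shows "self_orthogonal (vec.span R)"
proof -
  have dual_sym: "B \<subseteq> dual_code C" if "C \<subseteq> dual_code B" for B C :: "(bit ^ 'a) set"
    using that unfolding subset_iff mem_dual_code_iff
    by (subst conj_commute) blast
  have "vec.span R \<subseteq> dual_code R"
    using assms subspace_dual_code by (rule vec.span_minimal)
  hence "R \<subseteq> dual_code (vec.span R)" by (rule dual_sym)
  hence "vec.span R \<subseteq> dual_code (vec.span R)"
    using subspace_dual_code by (rule vec.span_minimal)
  thus ?thesis by (simp add: self_orthogonal_def)
qed

text \<open>Adding two words changes the weight by twice their overlap, and in a self-orthogonal code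
  overlaps are even; hence divisibility of the weight by 4 survives addition.\<close>

lemma doubly_even_span:
  assumes orth: "self_orthogonal (vec.span R)"
    and wt: "\<And>r. r \<in> R \<Longrightarrow> 4 dvd weight r"
  shows "doubly_even (vec.span R)"
proof -
  have "x \<in> vec.span R \<and> 4 dvd weight x" if "x \<in> vec.span R" for x
    using that
  proof (induction rule: vec.span_induct_alt)
    case base
    show ?case by (simp add: vec.span_zero weight_def)
  next
    case (step c x y)
    have x: "x \<in> vec.span R" using step by (simp add: vec.span_base)
    show ?case
    proof (cases "c = 0")
      case False
      have xy: "x + y \<in> vec.span R" using x step by (simp add: vec.span_add)
      have "x \<in> dual_code (vec.span R)"
        using orth x by (auto simp: self_orthogonal_def)
      hence "even (card {i. x $ i \<noteq> 0 \<and> y $ i \<noteq> 0})"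
        using step unfolding mem_dual_code_iff by blast
      hence "4 dvd 2 * card {i. x $ i \<noteq> 0 \<and> y $ i \<noteq> 0}" by auto
      moreover have "4 dvd weight x + weight y" using step wt by (simp add: dvd_add)
      ultimately have "4 dvd weight (x + y)"
        unfolding weight_add[symmetric] by (simp only: dvd_add_left_iff)
      moreover have "c *s x + y = x + y" using False by simp
      ultimately show ?thesis using xy by (simp only:)
    qed (use step in auto)
  qed
  thus ?thesis by (auto simp: doubly_even_def)
qed

lemma binary_code_of_even_overlaps:
  fixes D :: "('p::finite, 'b) incidence_structure"
  assumes size: "\<And>B. B \<in> blocks D \<Longrightarrow> 4 dvd card {p. incident D p B}"
    and overlap: "\<And>B C. B \<in> blocks D \<Longrightarrow> C \<in> blocks D \<Longrightarrow>
      even (card {p. incident D p B \<and> incident D p C})"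
  shows "doubly_even (binary_code D) \<and> self_orthogonal (binary_code D)"
proof -
  let ?R = "incidence_row D ` blocks D"
  have coord: "incidence_row D B $ p \<noteq> 0 \<longleftrightarrow> incident D p B" for B p
    by (simp add: incidence_row_def)
  have "?R \<subseteq> dual_code ?R"
    using overlap by (auto simp only: mem_dual_code_iff coord)
  hence "self_orthogonal (vec.span ?R)" by (rule self_orthogonal_span)
  moreover have "4 dvd weight r" if "r \<in> ?R" for r
    using that size by (auto simp only: weight_def coord)
  ultimately show ?thesis
    unfolding binary_code_def using doubly_even_span by blast
qed


section \<open>Lines and their parallel classes\<close>

lemma mem_coset_iff: "x \<in> (+) a ` V \<longleftrightarrow> x - a \<in> V" for a :: "'a::ab_group_add"
proof
  assume "x - a \<in> V"
  hence "a + (x - a) \<in> (+) a ` V" by (rule imageI)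
  thus "x \<in> (+) a ` V" by simp
qed auto

lemma coset_eq_iff:
  fixes V :: "('a::field ^ 'n) set"
  assumes "vec.subspace V"
  shows "(+) a ` V = (+) b ` V \<longleftrightarrow> a - b \<in> V"
proof
  assume "(+) a ` V = (+) b ` V"
  moreover have "a \<in> (+) a ` V" using assms by (simp add: mem_coset_iff vec.subspace_0)
  ultimately show "a - b \<in> V" by (simp add: mem_coset_iff)
next
  assume ab: "a - b \<in> V"
  have "x - a \<in> V \<longleftrightarrow> x - b \<in> V" for x
  proof
    assume "x - a \<in> V"
    from vec.subspace_add[OF assms this ab] show "x - b \<in> V" by simp
  next
    assume "x - b \<in> V"
    from vec.subspace_diff[OF assms this ab] show "x - a \<in> V" by simp
  qed
  hence "x \<in> (+) a ` V \<longleftrightarrow> x \<in> (+) b ` V" for x by (simp only: mem_coset_iff)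
  thus "(+) a ` V = (+) b ` V" by blast
qed

lemma coset_eqI:
  fixes V :: "('a::field ^ 'n) set"
  assumes "vec.subspace V" "x \<in> (+) a ` V"
  shows "(+) a ` V = (+) x ` V"
  using assms coset_eq_iff[of V x a] by (simp add: mem_coset_iff)

lemma cosets_disjoint:
  fixes V :: "('a::field ^ 'n) set"
  assumes "vec.subspace V" "L \<in> range (\<lambda>b. (+) b ` V)" "M \<in> range (\<lambda>b. (+) b ` V)" "L \<noteq> M"
  shows "L \<inter> M = {}"
  using assms coset_eqI[OF assms(1)] by blast

lemma parallel_classes_cases:
  assumes "P \<in> parallel_classes"
  obtains V where "vec.subspace V" "vec.dim V = 1" "P = range (\<lambda>b. (+) b ` V)"
proof -
  obtain a V where V: "vec.subspace V" "vec.dim V = 1" and P: "P = parallel_class ((+) a ` V)"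
    using assms by (auto simp: parallel_classes_def affine_flat_def)
  have translate: "(+) c ` (+) a ` V = (+) (c + a) ` V" for c
    by (simp add: image_image add.assoc)
  have "(+) b ` V \<in> P" for b
    using V translate[of "b - a"] unfolding P parallel_class_def affine_flat_def
    by (metis (mono_tags, lifting) diff_add_cancel mem_Collect_eq)
  moreover have "P \<subseteq> range (\<lambda>b. (+) b ` V)"
    unfolding P parallel_class_def using translate by auto
  ultimately have "P = range (\<lambda>b. (+) b ` V)" by auto
  with V that show thesis by blast
qed

lemma card_affine_line:
  fixes L :: "('a::{field,finite} ^ 'n) set"
  assumes "affine_line L"
  shows "card L = CARD('a)"
proof -
  obtain a V where V: "vec.subspace V" "vec.dim V = 1" and L: "L = (+) a ` V"
    using assms by (auto simp: affine_flat_def)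
  obtain B where B: "B \<subseteq> V" "vec.independent B" "V \<subseteq> vec.span B" "card B = vec.dim V"
    using vec.basis_exists by blast
  then obtain d where d: "B = {d}" using V(2) by (auto simp: card_1_singleton_iff)
  have "d \<noteq> 0" using B(2) d vec.dependent_zero by auto
  have "V = vec.span {d}" using B V(1) d vec.span_minimal by blast
  hence "V = range (\<lambda>k. k *s d)" by (simp add: vec.span_singleton)
  moreover have "inj (\<lambda>k. k *s d)" using \<open>d \<noteq> 0\<close> by (auto intro!: injI)
  ultimately show ?thesis unfolding L by (simp add: card_image)
qed

lemma one_dim_subspaces_cases:
  fixes V W :: "('a::field ^ 'n) set"
  assumes "vec.subspace V" "vec.subspace W" "vec.dim V = 1" "vec.dim W = 1"
  obtains "V = W" | "V \<inter> W = {0}"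
proof (cases "vec.dim (V \<inter> W) = 0")
  case True
  hence "V \<inter> W \<subseteq> {0}" by simp
  moreover have "0 \<in> V \<inter> W" using assms by (simp add: vec.subspace_0)
  ultimately show thesis using that(2) by blast
next
  case False
  hence dim: "vec.dim V \<le> vec.dim (V \<inter> W)" "vec.dim W \<le> vec.dim (V \<inter> W)"
    using assms by linarith+
  have "V \<inter> W = V" "V \<inter> W = W"
    by (rule vec.subspace_dim_equal[OF vec.subspace_inter]; use assms dim in blast)+
  thus thesis using that(1) by blast
qed


section \<open>Maximal arcs of lines and the sets of even type they cover\<close>

text \<open>A line transversal to the parallel class spans, together with the direction of the class,
  a plane. It meets each of the class lines in that plane exactly once, so its points covered by
  \<open>A\<close> correspond to the members of \<open>A\<close> in the plane, that is, to the points of \<open>A\<close> on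
  a line of the quotient plane.\<close>

lemma card_transversal_eq_card_quotient_line:
  fixes V W :: "('a::field ^ 3) set"
  assumes V: "vec.subspace V" "vec.dim V = 1" and W: "vec.subspace W" "vec.dim W = 1"
    and VW: "V \<inter> W = {0}"
    and P: "P = range (\<lambda>b. (+) b ` V)" and A: "A \<subseteq> P"
  obtains l where "l \<in> quotient_lines P" "card (\<Union>A \<inter> (+) b ` W) = card (A \<inter> l)"
proof -
  define F where "F = {v + w |v w. v \<in> V \<and> w \<in> W}"
  define E where "E = (+) b ` F"
  define l where "l = {L \<in> P. L \<subseteq> E}"
  have F: "vec.subspace F" unfolding F_def using V W by (intro vec.subspace_sums)
  have VF: "V \<subseteq> F" and WF: "W \<subseteq> F"
    using V W unfolding F_def by (force dest: vec.subspace_0)+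
  have "vec.dim F = 2"
    using vec.dim_sums_Int[OF V(1) W(1)] V(2) W(2) VW by (simp add: F_def)
  hence "affine_plane E" using F by (auto simp: affine_flat_def E_def)
  have coset_sub: "(+) x ` V \<subseteq> E" if "x \<in> E" for x
    using that coset_eqI[OF F, of x b] VF unfolding E_def by blast
  have self: "x \<in> (+) x ` V" for x using V by (simp add: mem_coset_iff vec.subspace_0)
  have "E = \<Union>l"
  proof (intro subset_antisym subsetI)
    fix x assume "x \<in> E"
    hence "(+) x ` V \<in> l" using coset_sub by (simp add: l_def P)
    thus "x \<in> \<Union>l" using self by (rule UnionI)
  qed (auto simp: l_def)
  moreover have "l \<subseteq> P" by (auto simp: l_def)
  ultimately have "l \<in> quotient_lines P"
    using \<open>affine_plane E\<close> unfolding quotient_lines_def l_def by blast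
  moreover have "bij_betw (\<lambda>x. (+) x ` V) (\<Union>A \<inter> (+) b ` W) (A \<inter> l)"
    unfolding bij_betw_def
  proof (intro conjI subset_antisym subsetI)
    show "inj_on (\<lambda>x. (+) x ` V) (\<Union>A \<inter> (+) b ` W)"
    proof (rule inj_onI)
      fix x y assume *: "x \<in> \<Union>A \<inter> (+) b ` W" "y \<in> \<Union>A \<inter> (+) b ` W" "(+) x ` V = (+) y ` V"
      have "x - y \<in> V" using * V by (simp add: coset_eq_iff)
      moreover have "(x - b) - (y - b) \<in> W"
        by (rule vec.subspace_diff[OF W(1)]) (use * in \<open>simp_all only: mem_coset_iff Int_iff\<close>)
      hence "x - y \<in> W" by simp
      ultimately have "x - y \<in> {0}" unfolding VW[symmetric] by (rule IntI)
      thus "x = y" by simp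
    qed
  next
    fix L assume "L \<in> (\<lambda>x. (+) x ` V) ` (\<Union>A \<inter> (+) b ` W)"
    then obtain x M where x: "x \<in> (+) b ` W" "L = (+) x ` V" "M \<in> A" "x \<in> M" by blast
    obtain a where "M = (+) a ` V" using A P x(3) by blast
    hence "L = M" using coset_eqI[OF V(1)] x by blast
    hence "L \<in> A" using x(3) by simp
    moreover have "x \<in> E" using x(1) WF unfolding E_def by blast
    hence "L \<subseteq> E" using coset_sub x(2) by simp
    ultimately show "L \<in> A \<inter> l" using A unfolding l_def by blast
  next
    fix L assume L: "L \<in> A \<inter> l"
    then obtain c where c: "L = (+) c ` V" using A P by blast
    have "L \<subseteq> E" using L by (simp add: l_def)
    hence "c \<in> E" using self[of c] c by blast
    then obtain v w where vw: "v \<in> V" "w \<in> W" "c = b + (v + w)"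
      by (auto simp: E_def F_def)
    \<comment> \<open>\<open>b + w\<close> is the point in which \<open>L\<close> meets the transversal line.\<close>
    have "(b + w) - c \<in> V" using vw V by (simp add: vec.subspace_neg)
    hence "b + w \<in> L" by (simp add: c mem_coset_iff)
    moreover from this have "L = (+) (b + w) ` V" using coset_eqI[OF V(1)] c by blast
    ultimately show "L \<in> (\<lambda>x. (+) x ` V) ` (\<Union>A \<inter> (+) b ` W)"
      using L vw(2) by blast
  qed
  hence "card (\<Union>A \<inter> (+) b ` W) = card (A \<inter> l)" by (rule bij_betw_same_card)
  ultimately show thesis by (rule that)
qed

text \<open>A transversal line meets \<open>\<Union>A\<close> in 0 or \<open>q / 2\<close> points, because \<open>A\<close> is a maximal
  arc; a line of the class \<open>P\<close> itself is contained in \<open>\<Union>A\<close> or disjoint from it. All of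
  the numbers \<open>0\<close>, \<open>q / 2\<close>, \<open>q\<close> are even.\<close>

lemma maximal_arc_union_meets_lines_evenly:
  fixes A :: "('a::{field,finite} ^ 3) set set"
  assumes "4 dvd CARD('a)" "P \<in> parallel_classes"
    and arc: "maximal_arc CARD('a) P (quotient_lines P) A" and M: "affine_line M"
  shows "even (card (\<Union>A \<inter> M))"
proof -
  obtain V where V: "vec.subspace V" "vec.dim V = 1" and P: "P = range (\<lambda>b. (+) b ` V)"
    using assms(2) by (rule parallel_classes_cases)
  obtain b W where W: "vec.subspace W" "vec.dim W = 1" and Mb: "M = (+) b ` W"
    using M by (auto simp: affine_flat_def)
  have A: "A \<subseteq> P" using arc by (simp add: maximal_arc_def)
  from V(1) W(1) V(2) W(2) show ?thesis
  proof (cases rule: one_dim_subspaces_cases)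
    case 1
    hence "M \<in> P" using P Mb by auto
    hence "L = M \<or> L \<inter> M = {}" if "L \<in> A" for L
      using that cosets_disjoint[OF V(1), of L M] A P by blast
    hence "\<Union>A \<inter> M = M \<or> \<Union>A \<inter> M = {}" by blast
    moreover have "even (card M)" using assms(1) card_affine_line[OF M] by presburger
    ultimately show ?thesis by auto
  next
    case 2
    obtain l where "l \<in> quotient_lines P" "card (\<Union>A \<inter> M) = card (A \<inter> l)"
      unfolding Mb by (rule card_transversal_eq_card_quotient_line[OF V W 2 P A])
    moreover from this have "card (A \<inter> l) = 0 \<or> card (A \<inter> l) = CARD('a) div 2"
      using arc by (simp only: maximal_arc_def)
    ultimately show ?thesis using assms(1) by presburger
  qed
qed

lemma card_Int_Union_parallel:
  fixes A :: "('a::{field,finite} ^ 'n) set set"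
  assumes "P \<in> parallel_classes" "A \<subseteq> P"
  shows "card (U \<inter> \<Union>A) = (\<Sum>L\<in>A. card (U \<inter> L))"
proof -
  obtain V where V: "vec.subspace V" and P: "P = range (\<lambda>b. (+) b ` V)"
    using assms(1) by (rule parallel_classes_cases)
  have "(U \<inter> L) \<inter> (U \<inter> M) = {}" if "L \<in> A" "M \<in> A" "L \<noteq> M" for L M
  proof -
    have "L \<inter> M = {}"
      using that assms(2) P by (intro cosets_disjoint[OF V]) auto
    thus ?thesis by blast
  qed
  hence "card (\<Union>((\<inter>) U ` A)) = (\<Sum>L\<in>A. card (U \<inter> L))"
    by (intro card_UN_disjoint ballI impI) simp_all
  thus ?thesis by (simp only: Int_Union)
qed


section \<open>The code of a design of Blokhuis-Haemers type\<close>

theorem corollary3p3: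
  fixes q m :: nat
    and D :: "(('a::{field,finite}) ^ 3, ('a ^ 3) set) incidence_structure"
  assumes "q = 2 ^ m" and "q \<ge> 4"
    and "blokhuis_haemers_type q D"
    and "quasi_symmetric D"
  shows "doubly_even (binary_code D) \<and> self_orthogonal (binary_code D)"
proof -
  have q: "CARD('a) = q" using assms(3) by (simp add: blokhuis_haemers_type_def)
  have "2 \<le> m"
  proof (rule ccontr)
    assume "\<not> 2 \<le> m"
    hence "m = 0 \<or> m = 1" by auto
    thus False using assms(1,2) by auto
  qed
  hence q4: "4 dvd CARD('a)"
    unfolding q assms(1) using le_imp_power_dvd[of 2 m "2::nat"] by simp
  have line: "affine_line L" if "L \<in> P" "P \<in> parallel_classes" for L and P :: "('a ^ 3) set set"
    using that by (auto simp: parallel_classes_def parallel_class_def)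
  have inc: "incident D = (\<in>)"
    using assms(3) by (auto simp: blokhuis_haemers_type_def set_structure_def)
  have block: "\<exists>P A. P \<in> parallel_classes \<and> maximal_arc q P (quotient_lines P) A \<and> B = \<Union>A"
    if BD: "B \<in> blocks D" for B
  proof -
    from assms(3) obtain \<A> :: "('a ^ 2) set set" and label
      where *: "\<forall>P \<in> parallel_classes. bij_betw (label P) P UNIV \<and>
          (\<forall>B \<in> \<A>. maximal_arc q P (quotient_lines P) {L \<in> P. label P L \<in> B})"
        and D: "D = set_structure UNIV
          {\<Union>{L \<in> P. label P L \<in> B} |P B. P \<in> parallel_classes \<and> B \<in> \<A>}"
      unfolding blokhuis_haemers_type_def by (elim conjE exE) (rule that; assumption)
    have arcs: "maximal_arc q P (quotient_lines P) {L \<in> P. label P L \<in> B'}"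
      if "P \<in> parallel_classes" "B' \<in> \<A>" for P B'
      using * that by simp
    obtain P B' where P: "P \<in> parallel_classes" "B' \<in> \<A>" and B: "B = \<Union>{L \<in> P. label P L \<in> B'}"
      using BD unfolding D set_structure_def by auto
    from P(1) arcs[OF P] B show ?thesis by (intro exI conjI)
  qed
  show ?thesis
  proof (rule binary_code_of_even_overlaps)
    fix B assume "B \<in> blocks D"
    then obtain P A where P: "P \<in> parallel_classes"
      and A: "maximal_arc q P (quotient_lines P) A" and B: "B = \<Union>A"
      using block by metis
    have AP: "A \<subseteq> P" using A by (simp add: maximal_arc_def)
    have "card B = (\<Sum>L\<in>A. card L)"
      using card_Int_Union_parallel[OF P AP, of UNIV] by (simp add: B)
    also have "4 dvd \<dots>"
    proof (rule dvd_sum)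
      fix L assume "L \<in> A"
      hence "affine_line L" using AP P line by blast
      thus "4 dvd card L" using q4 by (simp add: card_affine_line)
    qed
    finally show "4 dvd card {p. incident D p B}" by (simp add: inc)
  next
    \<comment> \<open>\<open>B\<close> serves as a set of even type, \<open>C\<close> as a disjoint union of lines.\<close>
    fix B C assume "B \<in> blocks D" "C \<in> blocks D"
    then obtain P A Q A' where P: "P \<in> parallel_classes" and Q: "Q \<in> parallel_classes"
      and A: "maximal_arc q P (quotient_lines P) A" and A': "maximal_arc q Q (quotient_lines Q) A'"
      and B: "B = \<Union>A" and C: "C = \<Union>A'"
      using block by metis
    have A'Q: "A' \<subseteq> Q" using A' by (simp add: maximal_arc_def)
    have "card (B \<inter> C) = (\<Sum>L\<in>A'. card (B \<inter> L))"
      unfolding C by (rule card_Int_Union_parallel[OF Q A'Q])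
    also have "even \<dots>"
    proof (rule dvd_sum)
      fix L assume "L \<in> A'"
      hence "affine_line L" using A'Q Q line by blast
      thus "even (card (B \<inter> L))"
        unfolding B using q4 P A q by (intro maximal_arc_union_meets_lines_evenly) auto
    qed
    finally show "even (card {p. incident D p B \<and> incident D p C})"
      by (simp add: inc Int_def)
  qed
qed

end
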